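(* Let $\Sigma=\{a,b,c\}$ and $w,w'\in\Sigma^*$. Let $t\ge 1$ and $0\le t'\le t$ be integers, and suppose $w$ contains $t$ (specified occurrences of) factors $\beta_1,\dots,\beta_t$ of the form $$\beta_k=\begin{cases} ab\,x_k\,ba & \text{for } 1\le k\le t',\\ ba\,x_k\,ab & \text{for } t'+1\le k\le t,\end{cases}$$ such that the following conditions hold: (1) $x_k\in\Sigma^*$ for $1\le k\le t$; (2) the displayed pairs $ab$ and $ba$ (the first two and the last two letters) of $\beta_m$ do not overlap, as positions in $w$, with the displayed pairs $ab$ and $ba$ of $\beta_n$ whenever $m\ne n$; (3) $\sum_{k=1}^{t'}|x_k|_c=\sum_{k=t'+1}^{t}|x_k|_c$. If $w'$ is obtained from $w$ by simultaneously rewriting, for every $1\le k\le t$, $\beta_k$ into $\beta_k'$, where $$\beta_k'=\begin{cases} ba\,x_k\,ab & \text{for } 1\le k\le t',\\ ab\,x_k\,ba & \text{for } t'+1\le k\le t\end{cases}$$ (that is, by swapping the two letters in each of the $2t$ displayed pairs), then $w$ and $w'$ are strongly $M$-equivalent.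
   Context: $\Sigma^*$ is the set of all finite words over $\Sigma$. For words $v,w$, $|w|_v$ is the number of occurrences of $v$ as a scattered subword (subsequence) of $w$, occurrences being distinguished by their positions; in particular $|w|_c$ is the number of letters $c$ in $w$. A factor of $w$ is a contiguous subword: $v$ is a factor of $w$ if $w=xvy$ for some words $x,y$. The factors $\beta_k$ may be nested or overlap one another, as long as the displayed pairs do not overlap. For an ordered alphabet $a_1<a_2<\cdots<a_k$, the Parikh matrix mapping is the monoid morphism from words to $(k+1)\times(k+1)$ upper triangular nonnegative integer matrices with unit diagonal, sending $a_q$ to the identity matrix with an additional $1$ in position $(q,q+1)$. Equivalently, the $(i,j+1)$ entry of the matrix of $w$ is $|w|_{a_ia_{i+1}\cdots a_j}$ for $1\le i\le j\le k$. Two words are $M$-equivalent with respect to an ordered alphabet if they have the same Parikh matrix with respect to it. Two words $w,w'\in\Sigma^*$ are strongly $M$-equivalent if they are $M$-equivalent with respect to every total ordering of the alphabet $\Sigma$. *)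

theory Defs
  imports Jordan_Normal_Form.Matrix "HOL-Combinatorics.Multiset_Permutations"
begin

(* A total ordering a_1 < ... < a_k of a finite alphabet is given by the list [a_1, ..., a_k];
   list and matrix indices start at 0, so the letter "as ! q" is sent to the identity matrix
   with an additional 1 in position (q, q + 1). *)

definition parikh_letter :: "'a list \<Rightarrow> 'a \<Rightarrow> nat mat" where
  "parikh_letter as l = mat (length as + 1) (length as + 1)
     (\<lambda>(i, j). if i = j then 1 else if j = i + 1 \<and> as ! i = l then 1 else 0)"

primrec parikh_matrix :: "'a list \<Rightarrow> 'a list \<Rightarrow> nat mat" where
  "parikh_matrix as [] = 1\<^sub>m (length as + 1)"
| "parikh_matrix as (l # w) = parikh_letter as l * parikh_matrix as w"

definition M_equivalent :: "'a list \<Rightarrow> 'a list \<Rightarrow> 'a list \<Rightarrow> bool" where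
  "M_equivalent as w w' \<longleftrightarrow> parikh_matrix as w = parikh_matrix as w'"

definition strongly_M_equivalent :: "'a set \<Rightarrow> 'a list \<Rightarrow> 'a list \<Rightarrow> bool" where
  "strongly_M_equivalent \<Sigma> w w' \<longleftrightarrow> (\<forall>as \<in> permutations_of_set \<Sigma>. M_equivalent as w w')"

definition factor_at :: "'a list \<Rightarrow> nat \<Rightarrow> 'a list \<Rightarrow> bool" where
  "factor_at v p w \<longleftrightarrow> (\<exists>u z. w = u @ v @ z \<and> length u = p)"

definition beta :: "'a \<Rightarrow> 'a \<Rightarrow> nat \<Rightarrow> (nat \<Rightarrow> 'a list) \<Rightarrow> nat \<Rightarrow> 'a list" where
  "beta a b t' x k = (if k \<le> t' then [a, b] @ x k @ [b, a] else [b, a] @ x k @ [a, b])"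

definition beta' :: "'a \<Rightarrow> 'a \<Rightarrow> nat \<Rightarrow> (nat \<Rightarrow> 'a list) \<Rightarrow> nat \<Rightarrow> 'a list" where
  "beta' a b t' x k = (if k \<le> t' then [b, a] @ x k @ [a, b] else [a, b] @ x k @ [b, a])"

(* The places, within a factor beta_k, of its first two and last two letters. *)

definition displayed_offsets :: "'a list \<Rightarrow> nat set" where
  "displayed_offsets y = {0, 1, length y + 2, length y + 3}"

definition displayed_positions :: "(nat \<Rightarrow> 'a list) \<Rightarrow> (nat \<Rightarrow> nat) \<Rightarrow> nat \<Rightarrow> nat set" where
  "displayed_positions x p k = (\<lambda>d. p k + d) ` displayed_offsets (x k)"

(* p k is the starting position in w of the k-th factor.  Since the factors may be nested or
   overlap, beta' k need not itself be a factor of w': the letters of x k may be changed by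
   the rewriting of other factors.  So beta' k only prescribes the displayed letters. *)

definition simultaneous_rewrite ::
  "'a \<Rightarrow> 'a \<Rightarrow> nat \<Rightarrow> nat \<Rightarrow> (nat \<Rightarrow> 'a list) \<Rightarrow> (nat \<Rightarrow> nat) \<Rightarrow> 'a list \<Rightarrow> 'a list \<Rightarrow> bool" where
  "simultaneous_rewrite a b t' t x p w w' \<longleftrightarrow>
     length w' = length w \<and>
     (\<forall>k \<in> {1..t}. \<forall>d \<in> displayed_offsets (x k). w' ! (p k + d) = beta' a b t' x k ! d) \<and>
     (\<forall>i < length w. i \<notin> (\<Union>k \<in> {1..t}. displayed_positions x p k) \<longrightarrow> w' ! i = w ! i)"

end

theory Submission
  imports Defs
begin

text \<open>
  Every entry of a Parikh matrix on or above the diagonal is the number of occurrences of a block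
  of the ordered alphabet as a scattered subword (lemma \<open>parikh_matrix_entry\<close>), so the claim is that all
  these counts agree for the two words.

  Consider one exchange \<open>u ab z \<mapsto> u ba z\<close> of adjacent letters.  A scattered occurrence of \<open>v\<close>
  is lost or created only if it uses both exchanged letters, and these are then consecutive in
  \<open>v\<close>.  Hence for \<open>v = s ab r\<close> without repeated letters the count of \<open>v\<close> drops by the number of
  occurrences of \<open>s\<close> in \<open>u\<close> times that of \<open>r\<close> in \<open>z\<close>, and for \<open>v = s ba r\<close> it rises by as much.
  Over \<open>{a, b, c}\<close> at least one of \<open>s\<close> and \<open>r\<close> is empty and the other is empty or the letter \<open>c\<close>.  Since the total number of letters
  \<open>c\<close> never changes, the drop is an affine function \<open>\<alpha> + \<beta> \<bar>u\<bar>\<^sub>c\<close> of the number of letters \<open>c\<close> to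
  the left of the exchange, with \<open>\<alpha>\<close> and \<open>\<beta>\<close> depending only on \<open>v\<close> and that total
  (lemma \<open>exchange_affine\<close>).

  Exchanging \<open>a\<close> with \<open>b\<close> moves no \<open>c\<close>, so many exchanges at disjoint places contribute
  independently, each with the value of \<open>\<bar>u\<bar>\<^sub>c\<close> read off the original word
  (lemma \<open>simultaneous_exchanges\<close>).  The two exchanges belonging to one factor have opposite signs, and
  their left contexts differ by \<open>\<bar>x\<^sub>k\<bar>\<^sub>c\<close> letters \<open>c\<close>: the constant \<open>\<alpha>\<close> cancels and
  \<open>\<plusminus>\<beta> \<bar>x\<^sub>k\<bar>\<^sub>c\<close> remains, with sign \<open>+\<close> for \<open>k \<le> t'\<close> and \<open>-\<close> for \<open>k > t'\<close>.  The balance condition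
  on the numbers \<open>\<bar>x\<^sub>k\<bar>\<^sub>c\<close> makes these contributions sum to zero.
\<close>

section \<open>Entries of Parikh matrices as scattered subword counts\<close>

fun scattered_count :: "'a list \<Rightarrow> 'a list \<Rightarrow> nat" where
  "scattered_count [] w = 1"
| "scattered_count (l # v) [] = 0"
| "scattered_count (l # v) (m # w) =
     scattered_count (l # v) w + (if l = m then scattered_count v w else 0)"

lemma scattered_count_single: "scattered_count [l] w = count_list w l"
  by (induction w) auto

lemma parikh_matrix_carrier:
  "parikh_matrix as w \<in> carrier_mat (length as + 1) (length as + 1)"
  by (induction w) (auto simp: parikh_letter_def)

text \<open>
  The matrix of a letter differs from the identity by entries just above the diagonal, so
  multiplying by it from the left adds to row \<open>i\<close> the row below it whenever \<open>l\<close> is the \<open>i\<close>-th letter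
  of the alphabet.  On scattered subword counts this is the choice of whether or not the first
  letter of the word is used.
\<close>

lemma parikh_letter_mult_entry:
  assumes "X \<in> carrier_mat (length as + 1) (length as + 1)" "i \<le> length as" "j \<le> length as"
  shows "(parikh_letter as l * X) $$ (i, j) =
    X $$ (i, j) + (if i < length as \<and> as ! i = l then X $$ (Suc i, j) else 0)"
proof -
  define n where "n = length as + 1"
  let ?e = "\<lambda>k. (if i = k then 1 else if k = i + 1 \<and> as ! i = l then 1 else 0) * X $$ (k, j)"
  have "(parikh_letter as l * X) $$ (i, j) = (\<Sum>k = 0..<n. ?e k)"
    using assms unfolding n_def
    by (auto simp: parikh_letter_def scalar_prod_def simp del: sum.op_ivl_Suc intro!: sum.cong)
  also have "\<dots> = (\<Sum>k = 0..<n. (if k = i then X $$ (k, j) else 0)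
      + (if k = Suc i then (if as ! i = l then X $$ (k, j) else 0) else 0))"
    by (intro sum.cong) auto
  also have "\<dots> = X $$ (i, j) + (if i < length as \<and> as ! i = l then X $$ (Suc i, j) else 0)"
    using assms by (simp add: sum.distrib n_def[symmetric]) (auto simp: n_def)
  finally show ?thesis .
qed

text \<open>
  Row \<open>i + 1\<close> belongs to the block starting one letter later, so the row operation above
  reproduces the recursion of \<^const>\<open>scattered_count\<close>.  The diagonal corresponds to the empty block.
\<close>

lemma parikh_matrix_entry:
  assumes "i \<le> length as" "j \<le> length as"
  shows "parikh_matrix as w $$ (i, j) =
    (if i \<le> j then scattered_count (take (j - i) (drop i as)) w else 0)"
  using assms
proof (induction w arbitrary: i)
  case Nil
  show ?case
  proof (cases "i < j")
    case True
    then have "take (j - i) (drop i as) \<noteq> []"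
      using Nil by simp
    then show ?thesis
      using True Nil by (cases "take (j - i) (drop i as)") simp_all
  qed (use Nil in auto)
next
  case (Cons l w)
  have step: "parikh_matrix as (l # w) $$ (i, j) = parikh_matrix as w $$ (i, j)
      + (if i < length as \<and> as ! i = l then parikh_matrix as w $$ (Suc i, j) else 0)"
    using parikh_letter_mult_entry[OF parikh_matrix_carrier Cons.prems] by simp
  show ?case
  proof (cases "i < j")
    case True
    then have "take (j - i) (drop i as) = as ! i # take (j - Suc i) (drop (Suc i) as)"
      using Cons.prems
      by (metis Suc_diff_Suc Cons_nth_drop_Suc less_le_trans take_Suc_Cons)
    then show ?thesis
      using True Cons.prems step Cons.IH[of i] Cons.IH[of "Suc i"] by auto
  qed (use Cons.prems step Cons.IH[of i] Cons.IH[of "Suc i"] in auto)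
qed

section \<open>Exchanging two adjacent letters\<close>

text \<open>
  Only occurrences that start with both exchanged letters distinguish the two words; what follows
  these two letters in \<open>v\<close> then has to occur in \<open>z\<close>.
\<close>

lemma exchange_at_front:
  assumes "a \<noteq> b"
  shows "int (scattered_count v (a # b # z)) - int (scattered_count v (b # a # z)) =
    (case v of l # m # r \<Rightarrow>
       (if l = a \<and> m = b then int (scattered_count r z)
        else if l = b \<and> m = a then - int (scattered_count r z) else 0)
     | _ \<Rightarrow> 0)"
proof (cases v)
  case (Cons l v')
  then show ?thesis using assms by (cases v') auto
qed simp

text \<open>
  An occurrence that uses both exchanged letters uses them consecutively, since no position lies
  between them.  If neither \<open>ab\<close> nor \<open>ba\<close> is a factor of \<open>v\<close>, no such occurrence exists, and moving
  the single exchanged letter that may be used gives a bijection.  The induction runs along \<open>u\<close>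
  because the hypothesis on \<open>v\<close> passes to its tail.
\<close>

lemma exchange_irrelevant:
  assumes "a \<noteq> b" "\<And>s r. v \<noteq> s @ [a, b] @ r" "\<And>s r. v \<noteq> s @ [b, a] @ r"
  shows "scattered_count v (u @ [a, b] @ z) = scattered_count v (u @ [b, a] @ z)"
  using assms(2,3)
proof (induction u arbitrary: v)
  case Nil
  have "\<not> (l = a \<and> m = b)" "\<not> (l = b \<and> m = a)" if "v = l # m # r" for l m r
    using Nil(1)[of "[]" r] Nil(2)[of "[]" r] that by auto
  then have "int (scattered_count v (a # b # z)) - int (scattered_count v (b # a # z)) = 0"
    unfolding exchange_at_front[OF assms(1)] by (cases v; cases "tl v") auto
  then show ?case by simp
next
  case (Cons y u)
  show ?case
  proof (cases v)
    case (Cons l v')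
    have "scattered_count v' (u @ [a, b] @ z) = scattered_count v' (u @ [b, a] @ z)"
    proof (rule Cons.IH)
      show "v' \<noteq> s @ [a, b] @ r" for s r using Cons.prems(1)[of "l # s" r] Cons by simp
      show "v' \<noteq> s @ [b, a] @ r" for s r using Cons.prems(2)[of "l # s" r] Cons by simp
    qed
    then show ?thesis using Cons.IH[OF Cons.prems] Cons by simp
  qed simp
qed

text \<open>
  Distinctness of the letters of \<open>v = s ab r\<close> makes its factor \<open>ab\<close> the only place where both
  exchanged letters can be used; \<open>s\<close> is then embedded into \<open>u\<close> and \<open>r\<close> into \<open>z\<close> independently.
\<close>

lemma exchange_relevant:
  assumes "a \<noteq> b" "distinct (s @ [a, b] @ r)"
  shows "int (scattered_count (s @ [a, b] @ r) (u @ [a, b] @ z))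
       - int (scattered_count (s @ [a, b] @ r) (u @ [b, a] @ z))
       = int (scattered_count s u * scattered_count r z)"
  using assms(2)
proof (induction u arbitrary: s)
  case Nil
  show ?case
  proof (cases s)
    case (Cons l s')
    then have "l \<noteq> a" "l \<noteq> b" using Nil by auto
    then show ?thesis using Cons by simp
  qed (use assms(1) in simp)
next
  case (Cons y u)
  show ?case
  proof (cases s)
    case Nil
    \<comment> \<open>Once the \<open>a\<close> of the factor has been matched inside \<open>u\<close>, the remaining subword lacks \<open>a\<close>
      and can no longer see the exchange.\<close>
    have "scattered_count (b # r) (u @ [a, b] @ z) = scattered_count (b # r) (u @ [b, a] @ z)"
    proof (rule exchange_irrelevant[OF assms(1)])
      have "a \<notin> set (b # r)" using Cons.prems assms(1) Nil by auto
      moreover have "a \<in> set (s @ [a, b] @ r')" "a \<in> set (s @ [b, a] @ r')" for s r' by auto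
      ultimately show "b # r \<noteq> s @ [a, b] @ r'" "b # r \<noteq> s @ [b, a] @ r'" for s r'
        by metis+
    qed
    then show ?thesis using Cons.IH[of "[]"] Cons.prems Nil by (cases "y = a") auto
  next
    case (Cons l s')
    then show ?thesis using Cons.IH[of s] Cons.IH[of s'] Cons.prems
      by (auto simp: algebra_simps)
  qed
qed

text \<open>
  Around a factor \<open>ab\<close> or \<open>ba\<close> of \<open>v\<close> only a single further letter \<open>c\<close> is available.  If it stands in
  front, the effect of the exchange is, up to sign, the number of letters \<open>c\<close> in \<open>u\<close>; if it stands behind, the
  effect is the number in \<open>z\<close>, which is \<open>n - \<bar>u\<bar>\<^sub>c\<close>.  Fixing the total \<open>n\<close> is what turns both cases
  into affine functions of the same quantity, with coefficients that do not depend on the place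
  of the exchange.
\<close>

lemma exchange_affine:
  assumes "distinct [a, b, c]" "distinct v" "set v \<subseteq> {a, b, c}"
  obtains \<alpha> \<beta> :: int where
    "\<And>u z. count_list (u @ z) c = n \<Longrightarrow>
       int (scattered_count v (u @ [a, b] @ z)) - int (scattered_count v (u @ [b, a] @ z))
       = \<alpha> + \<beta> * int (count_list u c)"
proof -
  have ab: "a \<noteq> b" and ba: "b \<noteq> a" using assms(1) by auto
  have flanks: "(s = [] \<or> s = [c]) \<and> (r = [] \<or> r = [c]) \<and> (s = [] \<or> r = [])"
    if "v = s @ [l, m] @ r" "{l, m} = {a, b}" for s r l m
  proof -
    have "set s \<subseteq> {c}" "set r \<subseteq> {c}" "distinct s" "distinct r" "set s \<inter> set r = {}"
      using that assms by (auto simp: doubleton_eq_iff)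
    moreover have "xs = [] \<or> xs = [c]" if "set xs \<subseteq> {c}" "distinct xs" for xs
      using that by (cases xs; cases "tl xs") auto
    ultimately have "s = [] \<or> s = [c]" "r = [] \<or> r = [c]" "set s \<inter> set r = {}" by blast+
    then show ?thesis by auto
  qed
  have product: "\<exists>\<alpha> \<beta>. \<forall>u z. count_list (u @ z) c = n \<longrightarrow>
      int (scattered_count s u * scattered_count r z) = \<alpha> + \<beta> * int (count_list u c)"
    if "(s = [] \<or> s = [c]) \<and> (r = [] \<or> r = [c]) \<and> (s = [] \<or> r = [])" for s r
  proof -
    from that consider "s = []" "r = []" | "s = [c]" "r = []" | "s = []" "r = [c]" by blast
    then show ?thesis
    proof cases
      case 1 then show ?thesis by (intro exI[of _ 1] exI[of _ 0]) simp
    next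
      case 2 then show ?thesis
        by (intro exI[of _ 0] exI[of _ 1]) (simp add: scattered_count_single)
    next
      case 3 then show ?thesis
        by (intro exI[of _ "int n"] exI[of _ "-1"]) (auto simp: scattered_count_single)
    qed
  qed
  consider s r where "v = s @ [a, b] @ r" | s r where "v = s @ [b, a] @ r"
    | "\<And>s r. v \<noteq> s @ [a, b] @ r" "\<And>s r. v \<noteq> s @ [b, a] @ r" by metis
  then show thesis
  proof cases
    case (1 s r)
    obtain \<alpha> \<beta> where *: "\<And>u z. count_list (u @ z) c = n \<Longrightarrow>
        int (scattered_count s u * scattered_count r z) = \<alpha> + \<beta> * int (count_list u c)"
      using product[OF flanks[OF 1]] by auto
    show thesis
    proof (rule that[of \<alpha> \<beta>])
      fix u z assume "count_list (u @ z) c = n"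
      with * exchange_relevant[OF ab, of s r u z] assms(2) 1
      show "int (scattered_count v (u @ [a, b] @ z)) - int (scattered_count v (u @ [b, a] @ z))
          = \<alpha> + \<beta> * int (count_list u c)"
        by auto
    qed
  next
    case (2 s r)
    obtain \<alpha> \<beta> where *: "\<And>u z. count_list (u @ z) c = n \<Longrightarrow>
        int (scattered_count s u * scattered_count r z) = \<alpha> + \<beta> * int (count_list u c)"
      using product[OF flanks[OF 2]] by auto
    show thesis
    proof (rule that[of "- \<alpha>" "- \<beta>"])
      fix u z assume "count_list (u @ z) c = n"
      with * exchange_relevant[OF ba, of s r u z] assms(2) 2
      show "int (scattered_count v (u @ [a, b] @ z)) - int (scattered_count v (u @ [b, a] @ z))
          = - \<alpha> + - \<beta> * int (count_list u c)"
        by auto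
    qed
  next
    case 3
    show thesis by (rule that[of 0 0]) (use exchange_irrelevant[OF ab 3] in simp)
  qed
qed

section \<open>Many simultaneous exchanges\<close>

text \<open>
  Exchanging letters other than \<open>c\<close> preserves all places of \<open>c\<close>, hence the number of letters \<open>c\<close> in
  every prefix; this is how left contexts in a partially rewritten word are compared with those
  in the original one.
\<close>

lemma count_list_take_cong:
  assumes "length v = length w" "\<And>i. i < length w \<Longrightarrow> v ! i = c \<longleftrightarrow> w ! i = c"
  shows "count_list (take n v) c = count_list (take n w) c"
proof -
  have "map (\<lambda>l. l = c) v = map (\<lambda>l. l = c) w"
    using assms by (intro nth_equalityI) auto
  moreover have "count_list xs c = length (filter id (map (\<lambda>l. l = c) xs))" for xs
    by (induction xs) auto
  ultimately show ?thesis by (metis take_map)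
qed

text \<open>
  The exchanges are carried out one after the other.  Each is adjacent in the word reached so
  far because the exchanged pairs are disjoint, and its left context there has as many letters \<open>c\<close>
  as in \<open>w\<close>, so the total effect is a sum of terms that refer to \<open>w\<close> alone.  The hypothesis on \<open>f\<close>
  is restricted to words with as many letters \<open>c\<close> as \<open>w\<close>, matching the fixed total under which
  subword counts change affinely.
\<close>

lemma simultaneous_exchanges:
  fixes f :: "'a list \<Rightarrow> int" and q :: "'j \<Rightarrow> nat"
  assumes "distinct [a, b, c]"
    and f: "\<And>u z. count_list (u @ z) c = count_list w c \<Longrightarrow>
       f (u @ [a, b] @ z) - f (u @ [b, a] @ z) = \<alpha> + \<beta> * int (count_list u c)"
    and "finite J"
    and "\<And>j. j \<in> J \<Longrightarrow> Suc (q j) < length w"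
    and "\<And>j. j \<in> J \<Longrightarrow> {w ! q j, w ! Suc (q j)} = {a, b}"
    and "\<And>i j. i \<in> J \<Longrightarrow> j \<in> J \<Longrightarrow> i \<noteq> j \<Longrightarrow> q i \<noteq> q j \<and> q i \<noteq> Suc (q j)"
    and "length w' = length w"
    and "\<And>j. j \<in> J \<Longrightarrow> w' ! q j = w ! Suc (q j) \<and> w' ! Suc (q j) = w ! q j"
    and "\<And>i. i < length w \<Longrightarrow> (\<And>j. j \<in> J \<Longrightarrow> i \<noteq> q j \<and> i \<noteq> Suc (q j)) \<Longrightarrow> w' ! i = w ! i"
  shows "f w' - f w = (\<Sum>j\<in>J. (if w ! q j = a then - 1 else 1)
           * (\<alpha> + \<beta> * int (count_list (take (q j) w) c)))"
  using assms(3-)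
proof (induction J arbitrary: w' rule: finite_induct)
  case empty
  then have "w' = w" by (intro nth_equalityI) auto
  then show ?case by simp
next
  case (insert j J)
  \<comment> \<open>Undoing the exchange at \<open>q j\<close> leaves a word \<open>v\<close> to which the induction hypothesis applies.\<close>
  define k where "k = q j"
  define v where "v = w'[k := w ! k, Suc k := w ! Suc k]"
  have k: "Suc k < length w" and pair: "{w ! k, w ! Suc k} = {a, b}"
    using insert.prems(1,2) by (auto simp: k_def)
  have w'k: "w' ! k = w ! Suc k" "w' ! Suc k = w ! k" using insert.prems(5) by (auto simp: k_def)
  have len: "length w' = length w" using insert.prems(4) .
  have off: "q i \<noteq> k \<and> q i \<noteq> Suc k \<and> Suc (q i) \<noteq> k" if "i \<in> J" for i
  proof -
    have "i \<noteq> j" using that insert.hyps by blast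
    then show ?thesis
      using insert.prems(3)[of i j] insert.prems(3)[of j i] that by (auto simp: k_def)
  qed
  have IH: "f v - f w = (\<Sum>j\<in>J. (if w ! q j = a then - 1 else 1)
           * (\<alpha> + \<beta> * int (count_list (take (q j) w) c)))"
  proof (rule insert.IH)
    show "v ! q i = w ! Suc (q i) \<and> v ! Suc (q i) = w ! q i" if "i \<in> J" for i
      using insert.prems(5)[of i] off[OF that] that by (auto simp: v_def)
    show "v ! i = w ! i" if "i < length w" "\<And>j. j \<in> J \<Longrightarrow> i \<noteq> q j \<and> i \<noteq> Suc (q j)" for i
    proof (cases "i = k \<or> i = Suc k")
      case False
      then show ?thesis using insert.prems(6)[of i] that by (auto simp: v_def k_def)
    qed (use k len in \<open>auto simp: v_def nth_list_update\<close>)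
  qed (use insert.prems len in \<open>auto simp: v_def\<close>)
  have same_c: "w' ! i = c \<longleftrightarrow> w ! i = c" if i: "i < length w" for i
  proof (cases "\<exists>m \<in> insert j J. i = q m \<or> i = Suc (q m)")
    case True
    then obtain m where m: "m \<in> insert j J" "i = q m \<or> i = Suc (q m)" by blast
    have "w ! q m \<noteq> c" "w ! Suc (q m) \<noteq> c"
      using insert.prems(2)[OF m(1)] assms(1) by (auto simp: doubleton_eq_iff)
    then show ?thesis using insert.prems(5)[OF m(1)] m(2) by auto
  next
    case False
    then have "w' ! i = w ! i" by (intro insert.prems(6)[OF i]) blast
    then show ?thesis by simp
  qed
  define u z where "u = take k w'" and "z = drop (k + 2) w'"
  have w'_split: "w' = u @ [w ! Suc k, w ! k] @ z"
    using k len w'k unfolding u_def z_def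
    by (simp add: Cons_nth_drop_Suc flip: w'k)
  have "length u = k" using k len by (simp add: u_def)
  then have v_split: "v = u @ [w ! k, w ! Suc k] @ z"
    unfolding v_def by (subst w'_split) (simp add: list_update_append)
  have cu: "count_list u c = count_list (take k w) c"
    unfolding u_def by (rule count_list_take_cong[OF len same_c])
  have "count_list w' c = count_list w c"
    using count_list_take_cong[OF len same_c, of "length w"] len by simp
  then have cuz: "count_list (u @ z) c = count_list w c"
    using pair assms(1) by (subst (asm) w'_split) (auto simp: doubleton_eq_iff)
  have "f w' - f v = (if w ! k = a then - 1 else 1) * (\<alpha> + \<beta> * int (count_list (take k w) c))"
    using f[OF cuz] pair assms(1) unfolding w'_split v_split cu
    by (auto simp: doubleton_eq_iff)
  then show ?case using IH insert.hyps by (simp add: k_def)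
qed

section \<open>Cancellation over the rewritten factors\<close>

lemma factor_at_nth:
  assumes "factor_at v p w" "d < length v"
  shows "w ! (p + d) = v ! d" "p + d < length w"
  using assms by (auto simp: factor_at_def nth_append)

lemma factor_at_count_between:
  assumes "factor_at ([l, m] @ y @ r) p w" "l \<noteq> c" "m \<noteq> c"
  shows "count_list (take (p + length y + 2) w) c = count_list (take p w) c + count_list y c"
  using assms by (auto simp: factor_at_def)

theorem theorem3p1:
  fixes a b c :: 'a
    and w w' :: "'a list"
    and t t' :: nat
    and x :: "nat \<Rightarrow> 'a list"
    and p :: "nat \<Rightarrow> nat"
  assumes "distinct [a, b, c]"
    and "w \<in> lists {a, b, c}"
    and "w' \<in> lists {a, b, c}"
    and "1 \<le> t"
    and "t' \<le> t"
    and "\<forall>k \<in> {1..t}. factor_at (beta a b t' x k) (p k) w"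
    and "\<forall>k \<in> {1..t}. x k \<in> lists {a, b, c}"
    and "\<forall>m \<in> {1..t}. \<forall>n \<in> {1..t}. m \<noteq> n \<longrightarrow>
           displayed_positions x p m \<inter> displayed_positions x p n = {}"
    and "(\<Sum>k = 1..t'. count_list (x k) c) = (\<Sum>k = t' + 1..t. count_list (x k) c)"
    and "simultaneous_rewrite a b t' t x p w w'"
  shows "strongly_M_equivalent {a, b, c} w w'"
proof -
  \<comment> \<open>The \<open>2 t\<close> exchanges are indexed by the factor and by which of its two displayed pairs is meant.\<close>
  define q where "q = (\<lambda>(k, right). if right then p k + length (x k) + 2 else p k)"
  have letters: "w ! p k = (if k \<le> t' then a else b)" "w ! Suc (p k) = (if k \<le> t' then b else a)"
      "w ! (p k + length (x k) + 2) = (if k \<le> t' then b else a)"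
      "w ! Suc (p k + length (x k) + 2) = (if k \<le> t' then a else b)"
      "Suc (p k + length (x k) + 2) < length w"
    if "k \<in> {1..t}" for k
  proof -
    have F: "factor_at (beta a b t' x k) (p k) w" using assms(6) that by blast
    note G = factor_at_nth[OF F]
    show "w ! p k = (if k \<le> t' then a else b)" "w ! Suc (p k) = (if k \<le> t' then b else a)"
      "w ! (p k + length (x k) + 2) = (if k \<le> t' then b else a)"
      "w ! Suc (p k + length (x k) + 2) = (if k \<le> t' then a else b)"
      "Suc (p k + length (x k) + 2) < length w"
      using G[of 0] G[of 1] G[of "length (x k) + 2"] G[of "length (x k) + 3"]
      by (auto simp: beta_def nth_append nth_Cons' eval_nat_numeral split: if_splits)
  qed
  have letters': "w' ! p k = (if k \<le> t' then b else a)" "w' ! Suc (p k) = (if k \<le> t' then a else b)"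
      "w' ! (p k + length (x k) + 2) = (if k \<le> t' then a else b)"
      "w' ! Suc (p k + length (x k) + 2) = (if k \<le> t' then b else a)"
    if "k \<in> {1..t}" for k
  proof -
    have G: "w' ! (p k + d) = beta' a b t' x k ! d" if "d \<in> {0, 1, length (x k) + 2, length (x k) + 3}" for d
      using assms(10) \<open>k \<in> {1..t}\<close> that
      unfolding simultaneous_rewrite_def displayed_offsets_def by blast
    show "w' ! p k = (if k \<le> t' then b else a)" "w' ! Suc (p k) = (if k \<le> t' then a else b)"
      "w' ! (p k + length (x k) + 2) = (if k \<le> t' then a else b)"
      "w' ! Suc (p k + length (x k) + 2) = (if k \<le> t' then b else a)"
      using G[of 0] G[of 1] G[of "length (x k) + 2"] G[of "length (x k) + 3"]
      by (auto simp: beta'_def nth_append nth_Cons' eval_nat_numeral split: if_splits)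
  qed
  have dpos: "displayed_positions x p k =
      {q (k, False), Suc (q (k, False)), q (k, True), Suc (q (k, True))}" for k
    by (auto simp: displayed_positions_def displayed_offsets_def q_def eval_nat_numeral)
  have between: "count_list (take (q (k, True)) w) c =
      count_list (take (q (k, False)) w) c + count_list (x k) c" if "k \<in> {1..t}" for k
    using factor_at_count_between[of _ _ "x k" _ "p k" w c] assms(1) assms(6)[rule_format, OF that]
    unfolding q_def beta_def by (auto split: if_splits)
  have entry: "scattered_count v w' = scattered_count v w"
    if v: "distinct v" "set v \<subseteq> {a, b, c}" for v
  proof -
    let ?f = "\<lambda>u. int (scattered_count v u)" and ?J = "{1..t} \<times> (UNIV :: bool set)"
    obtain \<alpha> \<beta> where affine: "\<And>u z. count_list (u @ z) c = count_list w c \<Longrightarrow>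
        ?f (u @ [a, b] @ z) - ?f (u @ [b, a] @ z) = \<alpha> + \<beta> * int (count_list u c)"
      using exchange_affine[OF assms(1) v] by blast
    let ?g = "\<lambda>j. (if w ! q j = a then - 1 else 1) * (\<alpha> + \<beta> * int (count_list (take (q j) w) c))"
    have "?f w' - ?f w = (\<Sum>j\<in>?J. ?g j)"
    proof (rule simultaneous_exchanges[OF assms(1) affine])
      show "q i \<noteq> q j \<and> q i \<noteq> Suc (q j)" if "i \<in> ?J" "j \<in> ?J" "i \<noteq> j" for i j
      proof (cases "fst i = fst j")
        case True
        with that show ?thesis by (cases i; cases j) (auto simp: q_def)
      next
        case False
        have "{q j, Suc (q j)} \<subseteq> displayed_positions x p (fst j)" for j
          by (cases j; cases "snd j") (auto simp: dpos)
        moreover have "displayed_positions x p (fst i) \<inter> displayed_positions x p (fst j) = {}"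
          using assms(8) that False by (auto simp: mem_Times_iff)
        ultimately show ?thesis by blast
      qed
      show "Suc (q j) < length w" if "j \<in> ?J" for j
        using that letters(5)[of "fst j"] by (auto simp: q_def)
      show "length w' = length w" using assms(10) by (simp add: simultaneous_rewrite_def)
      show "w' ! i = w ! i"
        if "i < length w" "\<And>j. j \<in> ?J \<Longrightarrow> i \<noteq> q j \<and> i \<noteq> Suc (q j)" for i
      proof -
        have "i \<notin> (\<Union>k \<in> {1..t}. displayed_positions x p k)"
          using that(2) by (auto simp: dpos)
        then show ?thesis using assms(10) that(1) by (simp add: simultaneous_rewrite_def)
      qed
    qed (use letters letters' in \<open>auto simp: q_def split: if_splits\<close>)
    \<comment> \<open>Pairing the two exchanges of each factor cancels \<open>\<alpha>\<close> and the letters \<open>c\<close> to the left of the factor.\<close>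
    also have "\<dots> = (\<Sum>k = 1..t. ?g (k, False) + ?g (k, True))"
      by (simp add: sum.cartesian_product' UNIV_bool add.commute)
    also have "\<dots> = (\<Sum>k = 1..t. \<beta> * ((if k \<le> t' then 1 else - 1) * int (count_list (x k) c)))"
    proof (rule sum.cong[OF refl])
      fix k assume k: "k \<in> {1..t}"
      have "w ! q (k, False) = (if k \<le> t' then a else b)" "w ! q (k, True) = (if k \<le> t' then b else a)"
        using letters[OF k] by (auto simp: q_def)
      then show "?g (k, False) + ?g (k, True) =
          \<beta> * ((if k \<le> t' then 1 else - 1) * int (count_list (x k) c))"
        using assms(1) between[OF k] by (auto simp: algebra_simps)
    qed
    also have "\<dots> = \<beta> * (\<Sum>k = 1..t. (if k \<le> t' then 1 else - 1) * int (count_list (x k) c))"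
      by (simp add: sum_distrib_left)
    also have "(\<Sum>k = 1..t. (if k \<le> t' then 1 else - 1) * int (count_list (x k) c)) =
        (\<Sum>k = 1..t'. int (count_list (x k) c)) - (\<Sum>k = t' + 1..t. int (count_list (x k) c))"
    proof -
      have "{1..t} = {1..t'} \<union> {t' + 1..t}" using assms(5) by auto
      then show ?thesis by (simp add: sum.union_disjoint sum_negf)
    qed
    also have "\<dots> = 0" using assms(9) by (simp flip: of_nat_sum)
    finally show ?thesis by simp
  qed
  show ?thesis
    unfolding strongly_M_equivalent_def M_equivalent_def
  proof (intro ballI eq_matI)
    fix as i j
    assume as: "as \<in> permutations_of_set {a, b, c}"
      and "i < dim_row (parikh_matrix as w')" "j < dim_col (parikh_matrix as w')"
    then have ij: "i \<le> length as" "j \<le> length as"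
      using parikh_matrix_carrier[of as w'] by auto
    have "distinct as" "set as = {a, b, c}" using as by (auto simp: permutations_of_set_def)
    then have "distinct (take (j - i) (drop i as))" "set (take (j - i) (drop i as)) \<subseteq> {a, b, c}"
      by (auto dest!: in_set_takeD in_set_dropD)
    then show "parikh_matrix as w $$ (i, j) = parikh_matrix as w' $$ (i, j)"
      using entry by (simp add: parikh_matrix_entry[OF ij])
  qed (use parikh_matrix_carrier in \<open>metis carrier_matD\<close>)+
qed

end
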